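(* Let $d\in\{1,2,3\}$ and let $K\subset M^{m\times n}$ be a $d$-dimensional linear subspace. Then $\mathcal{M}^{pc}(K)$ consists of Dirac measures if and only if $K$ does not contain Rank-$1$ connections.
   Context: $M^{m\times n}$ denotes real $m\times n$ matrices. For $X\in M^{m\times n}$, $\hat X$ is the vector of all minors of $X$; $f$ is polyconvex if $f(X)=g(\hat X)$ with $g$ convex. For $\mathcal{K}\subset M^{m\times n}$, $\mathcal{M}^{pc}(\mathcal{K})$ is the set of probability measures $\nu$ with $\mathrm{Spt}\,\nu\subset\mathcal{K}$ and $\int f\,d\nu\ge f(\int X\,d\nu)$ for all polyconvex $f$ (equivalently $\nu$ commutes with all minors). A set $\Sigma$ has Rank-$1$ connections if there exist $A\ne B$ in $\Sigma$ with $\mathrm{Rank}(A-B)=1$. *)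

theory Defs
  imports "HOL-Analysis.Analysis" "HOL-Probability.Probability"
begin

definition det_k :: "nat \<Rightarrow> (nat \<Rightarrow> nat \<Rightarrow> real) \<Rightarrow> real" where
  "det_k k M = (\<Sum>p | p permutes {..<k}. of_int (sign p) * (\<Prod>i<k. M i (p i)))"

definition minor :: "real^'n::{finite,linorder}^'m::{finite,linorder} \<Rightarrow> 'm set \<Rightarrow> 'n set \<Rightarrow> real" where
  "minor X I J = det_k (card I)
     (\<lambda>i j. X $ (sorted_list_of_set I ! i) $ (sorted_list_of_set J ! j))"

definition minors :: "real^'n::{finite,linorder}^'m::{finite,linorder} \<Rightarrow> real^('m set \<times> 'n set)" where
  "minors X = (\<chi> IJ. if card (fst IJ) = card (snd IJ) \<and> card (fst IJ) \<ge> 1 then minor X (fst IJ) (snd IJ) else 0)"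

definition polyconvex :: "(real^'n::{finite,linorder}^'m::{finite,linorder} \<Rightarrow> real) \<Rightarrow> bool" where
  "polyconvex f \<longleftrightarrow> (\<exists>g. convex_on UNIV g \<and> (\<forall>X. f X = g (minors X)))"

definition Spt :: "'a::metric_space measure \<Rightarrow> 'a set" where
  "Spt \<nu> = {x. \<forall>e>0. emeasure \<nu> (ball x e) \<noteq> 0}"

text \<open>Polyconvex measures supported in K: Borel probability measures whose minors are
  integrable (so that all quantities are defined) and which satisfy Jensen's inequality
  for every integrable polyconvex function.\<close>
definition Mpc :: "(real^'n::{finite,linorder}^'m::{finite,linorder}) set
    \<Rightarrow> (real^'n::{finite,linorder}^'m::{finite,linorder}) measure set" where
  "Mpc K = {\<nu>. prob_space \<nu> \<and> sets \<nu> = sets borel \<and> Spt \<nu> \<subseteq> K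
      \<and> integrable \<nu> (\<lambda>X. X) \<and> integrable \<nu> minors
      \<and> (\<forall>f. polyconvex f \<longrightarrow> integrable \<nu> f \<longrightarrow>
             f (integral\<^sup>L \<nu> (\<lambda>X. X)) \<le> integral\<^sup>L \<nu> f)}"

definition rank1_connections :: "(real^'n^'m) set \<Rightarrow> bool" where
  "rank1_connections \<Sigma> \<longleftrightarrow> (\<exists>A\<in>\<Sigma>. \<exists>B\<in>\<Sigma>. A \<noteq> B \<and> rank (A - B) = 1)"

end

theory Submission
  imports Defs
begin

text \<open>Only the 2 by 2 minors matter. If the subspace \<open>K\<close> contains no rank-one matrix and
  has dimension at most 3, then some linear combination \<open>q\<close> of 2 by 2 minors is positive definite
  on \<open>K\<close>. A polyconvex measure with barycentre \<open>Z\<close> satisfies \<open>\<integral> q (X - Z) = 0\<close>, so it is concentrated at \<open>Z\<close>.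

  By separation, if no such \<open>q\<close> exists, there are finitely many matrices \<open>Y\<^sub>i\<close> in \<open>K\<close>, not all zero, whose
  2 by 2 minors add up to zero. The bilinear map \<open>v x y = (x \<bullet> Y\<^sub>i y)\<^sub>i\<close> then has the exchange symmetry
  \<open>v x y \<bullet> v x' y' = v x y' \<bullet> v x' y\<close>, its values span a space \<open>S\<close> of dimension at most 3, and a
  vector \<open>c\<close> such that \<open>c \<bullet> v x y\<close> is a nonzero product \<open>\<alpha> x * \<beta> y\<close> yields the rank-one matrix
  \<open>\<Sum>c\<^sub>i Y\<^sub>i\<close> in \<open>K\<close>. For generic \<open>x\<^sub>0\<close>, the kernel of \<open>v x\<^sub>0\<close> is contained in that of every \<open>v x\<close>. If
  \<open>v x\<^sub>0\<close> maps onto \<open>S\<close>, the maps \<open>v x \<circ> (v x\<^sub>0)\<^sup>-\<^sup>1\<close> are commuting self-adjoint operators on \<open>S\<close>,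
  and \<open>c\<close> is a common eigenvector; likewise with the two arguments exchanged. Otherwise \<open>v x\<close>
  depends on \<open>x\<close> only through a quotient of dimension at most 2, and any \<open>c\<close> orthogonal to the range
  of \<open>v x\<^sub>0\<close> but not to \<open>S\<close> works.

  Conversely, for a rank-one matrix \<open>C\<close> in \<open>K\<close>, all minors of order at least 2 vanish at \<open>C\<close> and \<open>-C\<close>,
  so the uniform measure on \<open>{C, -C}\<close> is polyconvex.\<close>

section \<open>Commuting self-adjoint operators\<close>

definition selfadjoint_on :: "'a::real_inner set \<Rightarrow> ('a \<Rightarrow> 'a) \<Rightarrow> bool" where
  "selfadjoint_on S f \<longleftrightarrow> linear f \<and> f ` S \<subseteq> S \<and> (\<forall>x\<in>S. \<forall>y\<in>S. f x \<bullet> y = x \<bullet> f y)"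

lemma
  assumes "selfadjoint_on S f"
  shows selfadjoint_on_linear: "linear f"
    and selfadjoint_on_closed: "x \<in> S \<Longrightarrow> f x \<in> S"
    and selfadjoint_on_inner: "x \<in> S \<Longrightarrow> y \<in> S \<Longrightarrow> f x \<bullet> y = x \<bullet> f y"
  using assms by (auto simp: selfadjoint_on_def)

lemma selfadjoint_on_nonneg_eq_0:
  assumes selfadjoint: "selfadjoint_on S f" and subspace: "subspace S"
    and nonneg: "\<And>x. x \<in> S \<Longrightarrow> 0 \<le> f x \<bullet> x"
    and u_in: "u \<in> S" and null: "f u \<bullet> u = 0"
  shows "f u = 0"
proof -
  note linear = selfadjoint_on_linear[OF selfadjoint]
  define w where "w = f u"
  define q where "q t = t\<^sup>2 * (f w \<bullet> w) + 2 * t * (w \<bullet> w)" for t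
  have w_in: "w \<in> S"
    unfolding w_def by (rule selfadjoint_on_closed[OF selfadjoint u_in])
  have q_eq: "q t = f (u + t *\<^sub>R w) \<bullet> (u + t *\<^sub>R w)" for t
    using selfadjoint_on_inner[OF selfadjoint w_in u_in] null
    by (simp add: q_def linear_add[OF linear] linear_scale[OF linear] inner_add_right
        power2_eq_square algebra_simps flip: w_def)
  have "(q has_real_derivative 2 * (w \<bullet> w)) (at 0)"
    unfolding q_def by (auto intro!: derivative_eq_intros)
  moreover have "q 0 \<le> q t" for t
    using nonneg[of "u + t *\<^sub>R w"] u_in w_in subspace
    by (simp add: q_eq subspace_add subspace_scale null)
  ultimately have "2 * (w \<bullet> w) = 0"
    by (intro DERIV_local_min[of q _ 0 1]) auto
  then show ?thesis by (simp add: w_def)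
qed

lemma compact_sphere_Int_subspace:
  fixes S :: "'a::euclidean_space set"
  shows "subspace S \<Longrightarrow> compact (sphere a r \<inter> S)"
  by (simp add: compact_Int_closed closed_subspace)

lemma normalize_in_sphere_Int_subspace:
  assumes "subspace S" "x \<in> S" "x \<noteq> 0"
  shows "(1 / norm x) *\<^sub>R x \<in> sphere 0 1 \<inter> S"
  using assms by (simp add: subspace_scale)

lemma quadratic_form_attains_max_on_subspace:
  fixes S :: "'a::euclidean_space set"
  assumes linear: "linear f" and subspace: "subspace S" and nontrivial: "S \<noteq> {0}"
  obtains u where "u \<in> S" "norm u = 1" "\<And>x. x \<in> S \<Longrightarrow> f x \<bullet> x \<le> (f u \<bullet> u) * (x \<bullet> x)"
proof -
  let ?B = "sphere 0 1 \<inter> S"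
  have "?B \<noteq> {}"
    using normalize_in_sphere_Int_subspace[OF subspace] subspace_0[OF subspace] nontrivial by blast
  moreover have "continuous_on ?B (\<lambda>x. f x \<bullet> x)"
    using linear
    by (intro continuous_intros linear_continuous_on) (simp add: linear_conv_bounded_linear)
  ultimately obtain u where u_in: "u \<in> ?B" and max: "\<And>x. x \<in> ?B \<Longrightarrow> f x \<bullet> x \<le> f u \<bullet> u"
    using continuous_attains_sup[OF compact_sphere_Int_subspace[OF subspace]] by blast
  have "f x \<bullet> x \<le> (f u \<bullet> u) * (x \<bullet> x)" if "x \<in> S" for x
  proof (cases "x = 0")
    case False
    then have "(f x \<bullet> x) / (norm x * norm x) \<le> f u \<bullet> u"
      using max[OF normalize_in_sphere_Int_subspace[OF subspace that]]
      by (simp add: linear_scale[OF linear])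
    then show ?thesis
      using False by (simp add: dot_square_norm power2_eq_square divide_simps)
  qed simp
  then show thesis
    using that[of u] u_in by simp
qed

lemma selfadjoint_on_ex_eigenvector:
  fixes S :: "'a::euclidean_space set"
  assumes selfadjoint: "selfadjoint_on S f" and subspace: "subspace S" and nontrivial: "S \<noteq> {0}"
  obtains l c where "c \<in> S" "c \<noteq> 0" "f c = l *\<^sub>R c"
proof -
  note linear = selfadjoint_on_linear[OF selfadjoint]
  obtain u where u_in: "u \<in> S" and unit: "norm u = 1"
    and max: "\<And>x. x \<in> S \<Longrightarrow> f x \<bullet> x \<le> (f u \<bullet> u) * (x \<bullet> x)"
    using quadratic_form_attains_max_on_subspace[OF linear subspace nontrivial] by blast
  let ?g = "\<lambda>x. (f u \<bullet> u) *\<^sub>R x - f x"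
  have "selfadjoint_on S ?g"
    unfolding selfadjoint_on_def
    using subspace linear selfadjoint_on_closed[OF selfadjoint] selfadjoint_on_inner[OF selfadjoint]
    by (auto simp: inner_diff_left inner_diff_right subspace_diff subspace_scale
        intro!: linear_compose_sub linear_scale_self)
  moreover have "0 \<le> ?g x \<bullet> x" if "x \<in> S" for x
    using max[OF that] by (simp add: inner_diff_left)
  moreover have "?g u \<bullet> u = 0"
    using unit by (simp add: inner_diff_left dot_square_norm)
  ultimately have "?g u = 0"
    using selfadjoint_on_nonneg_eq_0[OF _ subspace _ u_in] by blast
  moreover have "u \<noteq> 0"
    using unit by auto
  ultimately show thesis
    using that[of u "f u \<bullet> u"] u_in by simp
qed

lemma selfadjoint_on_ex_common_eigenvector:
  fixes f :: "'i \<Rightarrow> 'a::euclidean_space \<Rightarrow> 'a"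
  assumes selfadjoint: "\<And>i. selfadjoint_on S (f i)"
    and subspace: "subspace S" and nontrivial: "S \<noteq> {0}"
    and commute: "\<And>i j x. x \<in> S \<Longrightarrow> f i (f j x) = f j (f i x)"
  obtains c l where "c \<in> S" "c \<noteq> 0" "\<And>i. f i c = l i *\<^sub>R c"
proof -
  let ?invariant = "\<lambda>H. subspace H \<and> H \<noteq> {0} \<and> H \<subseteq> S \<and> (\<forall>i. f i ` H \<subseteq> H)"
  have "?invariant S"
    using subspace nontrivial selfadjoint by (auto dest: selfadjoint_on_closed)
  then obtain H where invariant: "?invariant H"
    and minimal: "\<And>H'. ?invariant H' \<Longrightarrow> dim H \<le> dim H'"
    using ex_has_least_nat[of ?invariant S dim] by blast
  have "\<exists>l. \<forall>x\<in>H. f i x = l *\<^sub>R x" for i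
  proof -
    have "selfadjoint_on H (f i)"
      using selfadjoint[of i] invariant unfolding selfadjoint_on_def by blast
    then obtain l c where eigenvector: "c \<in> H" "c \<noteq> 0" "f i c = l *\<^sub>R c"
      using invariant selfadjoint_on_ex_eigenvector by metis
    let ?E = "{x \<in> H. f i x = l *\<^sub>R x}"
    have eigenspace: "subspace ?E"
      using invariant selfadjoint_on_linear[OF selfadjoint[of i]]
      by (auto simp: subspace_def linear_add linear_scale linear_0 algebra_simps)
    have "f j x \<in> ?E" if "x \<in> ?E" for j x
      using that invariant commute[of x i j] selfadjoint_on_linear[OF selfadjoint[of j]]
      by (auto simp: linear_scale)
    then have "dim H \<le> dim ?E"
      using invariant eigenspace eigenvector by (intro minimal) blast
    then have "?E = H"
      using invariant eigenspace by (intro subspace_dim_equal) auto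
    then show ?thesis by blast
  qed
  then obtain l where "\<And>i x. x \<in> H \<Longrightarrow> f i x = l i *\<^sub>R x" by metis
  moreover obtain c where "c \<in> H" "c \<noteq> 0" using invariant subspace_0 by blast
  ultimately show thesis using that[of c l] invariant by (metis subsetD)
qed

section \<open>Bilinear maps with exchange symmetry\<close>

lemma linear_factorization:
  assumes linear_f: "linear f" and linear_g: "linear g" and kernel: "\<And>x. f x = 0 \<Longrightarrow> g x = 0"
  obtains h where "linear h" "\<And>x. h (f x) = g x"
proof -
  obtain r where linear_r: "linear r" and right_inverse: "\<And>x. f (r (f x)) = f x"
    using linear_exists_right_inverse_on[OF linear_f subspace_UNIV] by auto
  have "g (r (f x)) = g x" for x
    using kernel[of "r (f x) - x"]
    by (simp add: linear_diff[OF linear_f] linear_diff[OF linear_g] right_inverse)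
  then show thesis
    using that[of "g \<circ> r"] linear_compose[OF linear_r linear_g] by simp
qed

lemma subspace_dim_le_2_combination:
  fixes U :: "'a::euclidean_space set"
  assumes subspace: "subspace U" and dim: "dim U \<le> 2" and u_in: "u \<in> U" and u_nz: "u \<noteq> 0"
  shows "\<exists>w\<in>U. \<forall>x\<in>U. \<exists>a b. x = a *\<^sub>R u + b *\<^sub>R w"
proof -
  have "\<exists>w\<in>U. U \<subseteq> span {u, w}"
  proof (cases "U \<subseteq> span {u}")
    case True
    then show ?thesis using u_in by (intro bexI[of _ u]) simp_all
  next
    case False
    then obtain w where w_in: "w \<in> U" and w_notin: "w \<notin> span {u}" by blast
    then have "u \<noteq> w" by (metis insertI1 span_base)
    then have "card {u, w} = 2" by simp
    moreover have "independent {w, u}"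
      using w_notin u_nz by (simp add: independent_insert)
    ultimately have "U \<subseteq> span {u, w}"
      using dim w_in u_in by (intro card_ge_dim_independent) (auto simp: insert_commute)
    then show ?thesis using w_in by blast
  qed
  then obtain w where w_in: "w \<in> U" and spanning: "U \<subseteq> span {u, w}" by blast
  have "\<exists>a b. x = a *\<^sub>R u + b *\<^sub>R w" if "x \<in> U" for x
  proof -
    have "x \<in> span {u, w}" using spanning that by blast
    then obtain a b where "x - a *\<^sub>R u = b *\<^sub>R w"
      by (auto simp: span_insert span_singleton)
    then show ?thesis by (metis add.commute diff_add_cancel)
  qed
  with w_in show ?thesis by blast
qed

text \<open>For \<open>A y + s B y = 0\<close> and \<open>A z + t B z = 0\<close>, the symmetry gives \<open>s (B y \<bullet> B z) = t (B y \<bullet> B z)\<close>;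
  so vectors \<open>B y\<close> belonging to distinct parameters are orthogonal, and only finitely many are
  nonzero.\<close>

lemma symmetric_pencil_kernel:
  fixes A B :: "'b \<Rightarrow> 'e::euclidean_space"
  assumes symmetric: "\<And>y z. A y \<bullet> B z = B y \<bullet> A z"
  obtains t :: real where "\<And>y. A y + t *\<^sub>R B y = 0 \<Longrightarrow> B y = 0"
proof (rule ccontr)
  assume "\<not> thesis"
  with that have "\<forall>t. \<exists>y. A y + t *\<^sub>R B y = 0 \<and> B y \<noteq> 0" by blast
  then obtain y where kernel: "\<And>t. A (y t) + t *\<^sub>R B (y t) = 0" and nz: "\<And>t. B (y t) \<noteq> 0"
    by metis
  have "A (y t) = - t *\<^sub>R B (y t)" for t
    using kernel[of t] by (simp add: eq_neg_iff_add_eq_0)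
  then have orthogonal: "orthogonal (B (y s)) (B (y t))" if "s \<noteq> t" for s t
    using symmetric[of "y s" "y t"] that by (simp add: orthogonal_def)
  have "inj (\<lambda>t. B (y t))"
    using orthogonal nz by (metis injI orthogonal_self)
  then have "infinite (range (\<lambda>t. B (y t)))"
    using finite_imageD infinite_UNIV_char_0 by blast
  moreover have "independent (range (\<lambda>t. B (y t)))"
    using orthogonal nz by (intro pairwise_orthogonal_independent) (auto simp: pairwise_def, metis)
  ultimately show False
    using independent_imp_finite by blast
qed

definition dominant :: "('a \<Rightarrow> 'b \<Rightarrow> 'e::zero) \<Rightarrow> 'a \<Rightarrow> bool" where
  "dominant v x\<^sub>0 \<longleftrightarrow> (\<forall>x y. v x\<^sub>0 y = 0 \<longrightarrow> v x y = 0)"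

definition splits :: "('a \<Rightarrow> 'b \<Rightarrow> 'e::real_inner) \<Rightarrow> 'e \<Rightarrow> bool" where
  "splits v c \<longleftrightarrow> (\<exists>\<alpha> \<beta>. \<forall>x y. c \<bullet> v x y = \<alpha> x * \<beta> y) \<and> (\<exists>x y. c \<bullet> v x y \<noteq> 0)"

lemma splitsI:
  assumes "\<And>x y. c \<bullet> v x y = \<alpha> x * \<beta> y" and "c \<bullet> v x\<^sub>1 y\<^sub>1 \<noteq> 0"
  shows "splits v c"
  using assms by (auto simp: splits_def)

lemma splits_flip: "splits (\<lambda>y x. v x y) c \<longleftrightarrow> splits v c"
  unfolding splits_def by (metis mult.commute)

locale exchange_symmetric =
  fixes v :: "'a::euclidean_space \<Rightarrow> 'b::euclidean_space \<Rightarrow> 'e::euclidean_space"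
  assumes bilinear: "bilinear v"
    and exchange: "v x y \<bullet> v x' y' = v x y' \<bullet> v x' y"
begin

lemma linear_right: "linear (v x)"
  using bilinear by (simp add: bilinear_def)

lemma linear_left: "linear (\<lambda>x. v x y)"
  using bilinear by (simp add: bilinear_def)

lemma exchange_symmetric_flip: "exchange_symmetric (\<lambda>y x. v x y)"
  by unfold_locales (use bilinear exchange in \<open>auto simp: bilinear_def inner_commute\<close>)

lemma subspace_range: "subspace (range (v x))"
  using linear_right subspace_UNIV by (rule linear_subspace_image)

lemma ex_dominant: "\<exists>x\<^sub>0. dominant v x\<^sub>0"
proof -
  let ?N = "\<lambda>x. {y. v x y = 0}"
  obtain x\<^sub>0 where minimal: "\<And>x. dim (?N x\<^sub>0) \<le> dim (?N x)"
    using ex_has_least_nat[of "\<lambda>_. True" undefined "\<lambda>x. dim (?N x)"] by blast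
  have "?N x\<^sub>0 \<subseteq> ?N x" for x
  proof -
    have "v x\<^sub>0 y \<bullet> v x z = v x y \<bullet> v x\<^sub>0 z" for y z
      using exchange[of x\<^sub>0 y x z] by (simp add: inner_commute)
    then obtain t where pencil_kernel: "\<And>y. v x\<^sub>0 y + t *\<^sub>R v x y = 0 \<Longrightarrow> v x y = 0"
      using symmetric_pencil_kernel[of "v x\<^sub>0" "v x"] by metis
    let ?x = "x\<^sub>0 + t *\<^sub>R x"
    have "v ?x y = v x\<^sub>0 y + t *\<^sub>R v x y" for y
      using bilinear by (simp add: bilinear_ladd bilinear_lmul)
    with pencil_kernel have "?N ?x \<subseteq> ?N x" and subset: "?N ?x \<subseteq> ?N x\<^sub>0" by force+
    moreover have "?N ?x = ?N x\<^sub>0"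
      using subset minimal by (intro subspace_dim_equal linear_subspace_kernel linear_right)
    ultimately show ?thesis by simp
  qed
  then show ?thesis unfolding dominant_def by blast
qed

lemma commuting_selfadjoint_operators:
  assumes dominant: "dominant v x\<^sub>0" and onto: "\<And>x y. v x y \<in> range (v x\<^sub>0)"
  obtains M where "\<And>x y. M x (v x\<^sub>0 y) = v x y"
    and "\<And>x. selfadjoint_on (range (v x\<^sub>0)) (M x)"
    and "\<And>x x' u. u \<in> range (v x\<^sub>0) \<Longrightarrow> M x (M x' u) = M x' (M x u)"
proof -
  let ?S = "range (v x\<^sub>0)"
  have "\<exists>h. linear h \<and> (\<forall>y. h (v x\<^sub>0 y) = v x y)" for x
    using linear_factorization[OF linear_right[of x\<^sub>0] linear_right[of x]] dominant
    unfolding dominant_def by metis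
  then obtain M where linear: "\<And>x. linear (M x)" and M_apply: "\<And>x y. M x (v x\<^sub>0 y) = v x y"
    by metis
  have selfadjoint: "selfadjoint_on ?S (M x)" for x
    unfolding selfadjoint_on_def
    using linear onto exchange[of x _ x\<^sub>0] by (auto simp: M_apply inner_commute)
  have "M x (M x' u) = M x' (M x u)" if u_in: "u \<in> ?S" for x x' u
  proof -
    note M_in = selfadjoint_on_closed[OF selfadjoint]
    have "M x (M x' u) \<bullet> w = M x' (M x u) \<bullet> w" if w_in: "w \<in> ?S" for w
    proof -
      obtain y z where preimages: "u = v x\<^sub>0 y" "w = v x\<^sub>0 z" using u_in w_in by blast
      have "M x (M x' u) \<bullet> w = M x' u \<bullet> M x w"
        using selfadjoint_on_inner[OF selfadjoint M_in[OF u_in] w_in] .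
      also have "\<dots> = M x u \<bullet> M x' w"
        using exchange[of x' y x z] by (simp add: preimages M_apply inner_commute)
      also have "\<dots> = M x' (M x u) \<bullet> w"
        using selfadjoint_on_inner[OF selfadjoint M_in[OF u_in] w_in] by simp
      finally show ?thesis .
    qed
    moreover have "M x (M x' u) - M x' (M x u) \<in> ?S"
      by (intro subspace_diff subspace_range M_in u_in)
    ultimately have "(M x (M x' u) - M x' (M x u)) \<bullet> (M x (M x' u) - M x' (M x u)) = 0"
      by (metis inner_diff_left right_minus_eq)
    then show ?thesis by simp
  qed
  with M_apply selfadjoint show thesis by (rule that)
qed

lemma ex_splits_if_onto:
  assumes dominant: "dominant v x\<^sub>0" and onto: "\<And>x y. v x y \<in> range (v x\<^sub>0)"
    and nz: "v x\<^sub>1 y\<^sub>1 \<noteq> 0"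
  shows "\<exists>c. splits v c"
proof -
  obtain M where M_apply: "\<And>x y. M x (v x\<^sub>0 y) = v x y"
    and selfadjoint: "\<And>x. selfadjoint_on (range (v x\<^sub>0)) (M x)"
    and commute: "\<And>x x' u. u \<in> range (v x\<^sub>0) \<Longrightarrow> M x (M x' u) = M x' (M x u)"
    using commuting_selfadjoint_operators[OF dominant onto] by metis
  have "range (v x\<^sub>0) \<noteq> {0}"
    using onto[of x\<^sub>1 y\<^sub>1] nz by force
  then obtain c l where c_in: "c \<in> range (v x\<^sub>0)" and c_nz: "c \<noteq> 0"
    and eigenvector: "\<And>x. M x c = l x *\<^sub>R c"
    using selfadjoint_on_ex_common_eigenvector[where f = M, OF selfadjoint subspace_range _ commute]
    by metis
  have "c \<bullet> v x y = l x * (c \<bullet> v x\<^sub>0 y)" for x y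
    using selfadjoint_on_inner[OF selfadjoint c_in, of "v x\<^sub>0 y" x] by (simp add: eigenvector M_apply)
  moreover obtain y where "c \<bullet> v x\<^sub>0 y \<noteq> 0"
    using c_in c_nz by (metis imageE inner_eq_zero_iff)
  ultimately have "splits v c"
    by (rule splitsI[where \<beta> = "\<lambda>y. c \<bullet> v x\<^sub>0 y"])
  then show ?thesis ..
qed

lemma dominant_decomposition:
  assumes dominant: "dominant (\<lambda>y x. v x y) y\<^sub>0" and nz: "v x\<^sub>0 y\<^sub>0 \<noteq> 0"
    and dim: "dim (range (\<lambda>x. v x y\<^sub>0)) \<le> 2"
  obtains z a b where "\<And>x y. v x y = a x *\<^sub>R v x\<^sub>0 y + b x *\<^sub>R v z y"
proof -
  interpret flip: exchange_symmetric "\<lambda>y x. v x y" by (rule exchange_symmetric_flip)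
  have "\<exists>w\<in>range (\<lambda>x. v x y\<^sub>0). \<forall>u\<in>range (\<lambda>x. v x y\<^sub>0). \<exists>a b. u = a *\<^sub>R v x\<^sub>0 y\<^sub>0 + b *\<^sub>R w"
    using flip.subspace_range dim rangeI nz by (rule subspace_dim_le_2_combination)
  then obtain z where "\<forall>x. \<exists>a b. v x y\<^sub>0 = a *\<^sub>R v x\<^sub>0 y\<^sub>0 + b *\<^sub>R v z y\<^sub>0" by auto
  then obtain a b where at_y\<^sub>0: "\<And>x. v x y\<^sub>0 = a x *\<^sub>R v x\<^sub>0 y\<^sub>0 + b x *\<^sub>R v z y\<^sub>0" by metis
  note left_simps = linear_diff[OF linear_left] linear_add[OF linear_left] linear_scale[OF linear_left]
  have "v x y = a x *\<^sub>R v x\<^sub>0 y + b x *\<^sub>R v z y" for x y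
  proof -
    have "v (x - (a x *\<^sub>R x\<^sub>0 + b x *\<^sub>R z)) y\<^sub>0 = 0"
      using at_y\<^sub>0[of x] by (simp add: left_simps)
    then have "v (x - (a x *\<^sub>R x\<^sub>0 + b x *\<^sub>R z)) y = 0"
      using dominant unfolding dominant_def by blast
    then show ?thesis by (simp add: left_simps)
  qed
  then show thesis by (rule that)
qed

lemma ex_splits_if_not_onto:
  assumes dominant_left: "dominant v x\<^sub>0" and dominant_right: "dominant (\<lambda>y x. v x y) y\<^sub>0"
    and dim: "dim (range (\<lambda>x. v x y\<^sub>0)) \<le> 2" and not_onto: "v x\<^sub>1 y\<^sub>1 \<notin> range (v x\<^sub>0)"
  shows "\<exists>c. splits v c"
proof -
  have "v x\<^sub>1 y\<^sub>1 \<noteq> 0"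
    using not_onto subspace_0[OF subspace_range] by metis
  then have "v x\<^sub>0 y\<^sub>0 \<noteq> 0"
    using dominant_left dominant_right unfolding dominant_def by blast
  then obtain z a b where decomposition: "\<And>x y. v x y = a x *\<^sub>R v x\<^sub>0 y + b x *\<^sub>R v z y"
    using dominant_decomposition[OF dominant_right _ dim] by metis
  have "v x\<^sub>1 y\<^sub>1 \<notin> (range (v x\<^sub>0))\<^sup>\<bottom>\<^sup>\<bottom>"
    using not_onto by (simp add: orthogonal_comp_self subspace_range)
  then obtain c where c_in: "c \<in> (range (v x\<^sub>0))\<^sup>\<bottom>" and c_nz: "c \<bullet> v x\<^sub>1 y\<^sub>1 \<noteq> 0"
    by (auto simp: orthogonal_comp_def orthogonal_def)
  have "c \<bullet> v x\<^sub>0 y = 0" for y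
    using c_in by (simp add: orthogonal_comp_def orthogonal_def inner_commute)
  then have "c \<bullet> v x y = b x * (c \<bullet> v z y)" for x y
    by (simp add: decomposition[of x] inner_add_right)
  then have "splits v c"
    using c_nz by (rule splitsI[where \<beta> = "\<lambda>y. c \<bullet> v z y"])
  then show ?thesis ..
qed

lemma ex_splits:
  assumes dim: "dim (range (\<lambda>(x, y). v x y)) \<le> 3" and nz: "v x\<^sub>1 y\<^sub>1 \<noteq> 0"
  shows "\<exists>c. splits v c"
proof -
  interpret flip: exchange_symmetric "\<lambda>y x. v x y" by (rule exchange_symmetric_flip)
  obtain x\<^sub>0 where dominant_left: "dominant v x\<^sub>0" using ex_dominant by blast
  obtain y\<^sub>0 where dominant_right: "dominant (\<lambda>y x. v x y) y\<^sub>0" using flip.ex_dominant by blast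
  consider (right_onto) "\<And>x y. v x y \<in> range (v x\<^sub>0)"
    | (left_onto) "\<And>y x. v x y \<in> range (\<lambda>x. v x y\<^sub>0)"
    | (not_onto) x y x' y' where "v x y \<notin> range (v x\<^sub>0)" "v x' y' \<notin> range (\<lambda>x. v x y\<^sub>0)"
    by blast
  then show ?thesis
  proof cases
    case right_onto
    then show ?thesis using ex_splits_if_onto[OF dominant_left _ nz] by blast
  next
    case left_onto
    then show ?thesis
      using flip.ex_splits_if_onto[OF dominant_right _ nz] splits_flip[of v] by blast
  next
    case not_onto
    let ?U = "range (\<lambda>x. v x y\<^sub>0)" and ?S = "span (range (\<lambda>(x, y). v x y))"
    have "v x y \<in> ?S" for x y
      by (rule span_base) force
    with not_onto(2) have "?U \<subset> ?S" by blast
    then have "dim ?U < dim ?S"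
      using subspace_dim_equal[OF flip.subspace_range subspace_span] by (metis not_le psubset_eq)
    then have "dim ?U \<le> 2" using dim by simp
    then show ?thesis
      using ex_splits_if_not_onto[OF dominant_left dominant_right _ not_onto(1)] by blast
  qed
qed

end

section \<open>Positive definite combinations of 2 by 2 minors\<close>

lemma rank_eq_1_iff:
  fixes A :: "real^'n^'m"
  shows "rank A = 1 \<longleftrightarrow> A \<noteq> 0 \<and> (\<exists>a b. \<forall>i j. A $ i $ j = a i * b j)"
proof (intro iffI conjI)
  assume rank: "rank A = 1"
  show "A \<noteq> 0" using rank by auto
  have "dim (range (\<lambda>x. A *v x)) = 1" using rank by (simp add: rank_dim_range)
  then obtain u where range: "range (\<lambda>x. A *v x) \<subseteq> span {u}"
    using basis_exists[of "range (\<lambda>x. A *v x)"] by (metis card_1_singletonE)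
  have "\<exists>t. \<forall>i. A $ i $ j = u $ i * t" for j
  proof -
    have "A *v axis j 1 \<in> span {u}" using range by blast
    then obtain t where "A *v axis j 1 = t *\<^sub>R u" by (auto simp: span_singleton)
    then have "\<forall>i. A $ i $ j = u $ i * t"
      by (auto simp: matrix_vector_mult_basis column_def vec_eq_iff mult.commute)
    then show ?thesis ..
  qed
  then show "\<exists>a b. \<forall>i j. A $ i $ j = a i * b j" by metis
next
  assume "A \<noteq> 0 \<and> (\<exists>a b. \<forall>i j. A $ i $ j = a i * b j)"
  then obtain a b where nz: "A \<noteq> 0" and product: "\<And>i j. A $ i $ j = a i * b j" by blast
  have "A *v x = (\<Sum>j\<in>UNIV. b j * x $ j) *\<^sub>R (\<chi> i. a i)" for x
    by (simp add: vec_eq_iff matrix_vector_mult_def product sum_distrib_left mult_ac)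
  then have "range (\<lambda>x. A *v x) \<subseteq> span {\<chi> i. a i}"
    by (auto simp: span_singleton)
  then have "dim (range (\<lambda>x. A *v x)) \<le> card {\<chi> i. a i}"
    by (intro dim_le_card) auto
  moreover have "dim (range (\<lambda>x. A *v x)) \<noteq> 0"
    using nz matrix_eq[of A 0] by (auto simp: dim_eq_0)
  ultimately show "rank A = 1" by (simp add: rank_dim_range del: dim_eq_0)
qed

text \<open>The components run over all index quadruples, so each minor occurs with both signs and
  degenerate ones vanish.\<close>

definition minors2 :: "real^'n^'m \<Rightarrow> real^('m \<times> 'm \<times> 'n \<times> 'n)" where
  "minors2 X = (\<chi> p. case p of (i, k, j, l) \<Rightarrow> X $ i $ j * X $ k $ l - X $ i $ l * X $ k $ j)"

lemma minors2_nth [simp]: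
  "minors2 X $ (i, k, j, l) = X $ i $ j * X $ k $ l - X $ i $ l * X $ k $ j"
  by (simp add: minors2_def)

lemma minors2_scaleR: "minors2 (t *\<^sub>R X) = t\<^sup>2 *\<^sub>R minors2 X"
  by (auto simp: vec_eq_iff power2_eq_square algebra_simps)

lemma minors2_0 [simp]: "minors2 0 = 0"
  using minors2_scaleR[of 0 0] by simp

lemma continuous_on_minors2: "continuous_on S minors2"
  unfolding minors2_def case_prod_unfold by (intro continuous_intros)

lemma bilinear_form_mult_eq_sum:
  fixes X :: "real^'n^'m"
  shows "(x \<bullet> (X *v y)) * (x' \<bullet> (X *v y')) =
    (\<Sum>i\<in>UNIV. \<Sum>k\<in>UNIV. \<Sum>j\<in>UNIV. \<Sum>l\<in>UNIV.
      x $ i * x' $ k * y $ j * y' $ l * (X $ i $ j * X $ k $ l))"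
proof -
  have "x \<bullet> (X *v y) = (\<Sum>i\<in>UNIV. \<Sum>j\<in>UNIV. x $ i * X $ i $ j * y $ j)" for x y
    by (simp add: inner_vec_def matrix_vector_mult_def sum_distrib_left mult_ac)
  then show ?thesis by (simp only: sum_product) (simp add: mult_ac)
qed

definition tensor4 :: "real^'m \<Rightarrow> real^'m \<Rightarrow> real^'n \<Rightarrow> real^'n \<Rightarrow> real^('m \<times> 'm \<times> 'n \<times> 'n)" where
  "tensor4 x x' y y' = (\<chi> p. case p of (i, k, j, l) \<Rightarrow> x $ i * x' $ k * y $ j * y' $ l)"

lemma bilinear_form_exchange_eq_minors2:
  fixes X :: "real^'n^'m"
  shows "(x \<bullet> (X *v y)) * (x' \<bullet> (X *v y')) - (x \<bullet> (X *v y')) * (x' \<bullet> (X *v y)) =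
    tensor4 x x' y y' \<bullet> minors2 X"
proof -
  have "(x \<bullet> (X *v y')) * (x' \<bullet> (X *v y)) =
      (\<Sum>i\<in>UNIV. \<Sum>k\<in>UNIV. \<Sum>j\<in>UNIV. \<Sum>l\<in>UNIV.
        x $ i * x' $ k * y $ j * y' $ l * (X $ i $ l * X $ k $ j))"
    unfolding bilinear_form_mult_eq_sum
    by (rule sum.cong[OF refl], rule sum.cong[OF refl], subst sum.swap) (simp add: mult_ac)
  moreover have "tensor4 x x' y y' \<bullet> minors2 X =
      (\<Sum>i\<in>UNIV. \<Sum>k\<in>UNIV. \<Sum>j\<in>UNIV. \<Sum>l\<in>UNIV.
        x $ i * x' $ k * y $ j * y' $ l * (X $ i $ j * X $ k $ l - X $ i $ l * X $ k $ j))"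
    by (simp add: tensor4_def minors2_def inner_vec_def sum.cartesian_product case_prod_unfold
        flip: UNIV_Times_UNIV)
  ultimately show ?thesis
    unfolding bilinear_form_mult_eq_sum by (simp add: right_diff_distrib sum_subtractf)
qed

definition combination :: "('i::finite \<Rightarrow> 'e::real_vector) \<Rightarrow> real^'i \<Rightarrow> 'e" where
  "combination Y c = (\<Sum>i\<in>UNIV. c $ i *\<^sub>R Y i)"

definition pairing :: "('i::finite \<Rightarrow> real^'n^'m) \<Rightarrow> real^'m \<Rightarrow> real^'n \<Rightarrow> real^'i" where
  "pairing Y x y = (\<chi> i. x \<bullet> (Y i *v y))"

lemma linear_combination: "linear (combination Y)"
  by (rule linearI) (simp_all add: combination_def scaleR_add_left sum.distrib scaleR_sum_right)

lemma combination_in_span: "combination Y c \<in> span (range Y)"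
  unfolding combination_def by (intro span_sum span_scale span_base rangeI)

lemma bilinear_pairing: "bilinear (pairing Y)"
  unfolding bilinear_def
  by (auto intro!: linearI simp: pairing_def vec_eq_iff inner_add_left inner_add_right
      matrix_vector_right_distrib matrix_vector_mult_scaleR)

lemma inner_pairing: "c \<bullet> pairing Y x y = x \<bullet> (combination Y c *v y)"
proof -
  have linear: "linear (\<lambda>A. A *v y)"
    by (rule linearI) (simp_all add: matrix_vector_mult_add_rdistrib scaleR_matrix_vector_assoc)
  have "combination Y c *v y = (\<Sum>i\<in>UNIV. c $ i *\<^sub>R (Y i *v y))"
    unfolding combination_def by (simp only: linear_sum[OF linear] linear_scale[OF linear])
  then show ?thesis by (simp add: inner_sum_right inner_vec_def[of c] pairing_def)
qed

lemma pairing_exchange: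
  assumes "(\<Sum>i\<in>UNIV. minors2 (Y i)) = 0"
  shows "pairing Y x y \<bullet> pairing Y x' y' = pairing Y x y' \<bullet> pairing Y x' y"
proof -
  have "pairing Y x y \<bullet> pairing Y x' y' - pairing Y x y' \<bullet> pairing Y x' y =
      tensor4 x x' y y' \<bullet> (\<Sum>i\<in>UNIV. minors2 (Y i))"
    by (simp add: pairing_def inner_vec_def[of "vec_lambda _" "vec_lambda _ :: real^_"] inner_sum_right
        bilinear_form_exchange_eq_minors2 flip: sum_subtractf)
  then show ?thesis by (simp add: assms)
qed

lemma dim_range_pairing_le: "dim (range (\<lambda>(x, y). pairing Y x y)) \<le> dim (range Y)"
proof -
  let ?G = "range (\<lambda>(x, y). pairing Y x y)"
  have "c = 0" if in_span: "c \<in> span ?G" and null: "combination Y c = 0" for c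
  proof -
    have "orthogonal c z" if "z \<in> ?G" for z
      using that null by (auto simp: orthogonal_def inner_pairing)
    then have "orthogonal c c" by (rule orthogonal_to_span[OF in_span])
    then show ?thesis by (simp add: orthogonal_self)
  qed
  then have "inj_on (combination Y) (span ?G)"
    using linear_inj_on_iff_eq_0[OF linear_combination subspace_span] by blast
  then have "dim ?G = dim (combination Y ` ?G)"
    using dim_image_eq[OF linear_combination] by metis
  also have "\<dots> \<le> dim (span (range Y))"
    using combination_in_span by (intro dim_subset) blast
  finally show ?thesis by simp
qed

lemma pairing_axis: "pairing Y (axis i 1) (axis j 1) $ k = Y k $ i $ j"
  by (simp add: pairing_def inner_axis' matrix_vector_mult_basis column_def)

lemma rank_combination_if_splits:
  assumes "splits (pairing Y) c"
  shows "rank (combination Y c) = 1"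
proof -
  obtain \<alpha> \<beta> where product: "\<And>x y. c \<bullet> pairing Y x y = \<alpha> x * \<beta> y"
    and nz: "\<exists>x y. c \<bullet> pairing Y x y \<noteq> 0"
    using assms unfolding splits_def by blast
  have "combination Y c $ i $ j = \<alpha> (axis i 1) * \<beta> (axis j 1)" for i j
    using product[of "axis i 1" "axis j 1"]
    by (simp add: inner_pairing inner_axis' matrix_vector_mult_basis column_def)
  moreover have "combination Y c \<noteq> 0"
    using nz by (auto simp: inner_pairing)
  ultimately show ?thesis
    unfolding rank_eq_1_iff
    by (intro conjI exI[of _ "\<lambda>i. \<alpha> (axis i 1)"] exI[of _ "\<lambda>j. \<beta> (axis j 1)"]) auto
qed

lemma ex_rank_1_if_sum_minors2_eq_0:
  fixes Y :: "'i::finite \<Rightarrow> real^'n^'m"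
  assumes dim: "dim (range Y) \<le> 3" and sum_eq_0: "(\<Sum>i\<in>UNIV. minors2 (Y i)) = 0"
    and nz: "Y i\<^sub>0 \<noteq> 0"
  shows "\<exists>C\<in>span (range Y). rank C = 1"
proof -
  interpret exchange_symmetric "pairing Y"
    by unfold_locales (rule bilinear_pairing, rule pairing_exchange[OF sum_eq_0])
  obtain i j where "Y i\<^sub>0 $ i $ j \<noteq> 0" using nz by (auto simp: vec_eq_iff)
  then have "pairing Y (axis i 1) (axis j 1) \<noteq> 0"
    by (metis pairing_axis zero_index)
  then obtain c where "splits (pairing Y) c"
    using ex_splits dim_range_pairing_le[of Y] dim by (metis order_trans)
  then have "rank (combination Y c) = 1" by (rule rank_combination_if_splits)
  then show ?thesis using combination_in_span by blast
qed

lemma convex_hull_caratheodory_indexed: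
  fixes S :: "(real^'i) set"
  assumes "z \<in> convex hull S"
  obtains u :: "'i option \<Rightarrow> real" and x :: "'i option \<Rightarrow> real^'i"
  where "\<And>i. 0 \<le> u i" "sum u UNIV = 1" "\<And>i. x i \<in> S" "(\<Sum>i\<in>UNIV. u i *\<^sub>R x i) = z"
proof -
  obtain T w where finite: "finite T" and T_subset: "T \<subseteq> S" and card: "card T \<le> DIM(real^'i) + 1"
    and w_nonneg: "\<And>y. y \<in> T \<Longrightarrow> 0 \<le> w y" and w_sum: "sum w T = 1"
    and w_combination: "(\<Sum>y\<in>T. w y *\<^sub>R y) = z"
    using assms unfolding convex_hull_caratheodory by blast
  have "card T \<le> card (UNIV :: 'i option set)"
    using card by (simp add: card_UNIV_option)
  then obtain h :: "real^'i \<Rightarrow> 'i option" where inj: "inj_on h T"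
    using card_le_inj[OF finite finite_class.finite_UNIV] by blast
  obtain y\<^sub>0 where y\<^sub>0_in: "y\<^sub>0 \<in> T" using w_sum by (cases "T = {}") auto
  define x where "x i = (if i \<in> h ` T then the_inv_into T h i else y\<^sub>0)" for i
  define u where "u i = (if i \<in> h ` T then w (x i) else 0)" for i
  have x_h: "x (h y) = y" if "y \<in> T" for y
    using that inj by (simp add: x_def the_inv_into_f_f)
  have "x i \<in> T" for i
    using y\<^sub>0_in inj by (auto simp: x_def the_inv_into_f_f)
  then have "x i \<in> S" "0 \<le> u i" for i
    using T_subset w_nonneg by (auto simp: u_def)
  moreover have reindex: "sum g UNIV = (\<Sum>y\<in>T. g (h y))" if "\<And>i. i \<notin> h ` T \<Longrightarrow> g i = 0"
    for g :: "'i option \<Rightarrow> 'b::comm_monoid_add"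
    using that inj by (subst sum.mono_neutral_right[of UNIV "h ` T"]) (auto simp: sum.reindex)
  have "sum u UNIV = 1" "(\<Sum>i\<in>UNIV. u i *\<^sub>R x i) = z"
    using w_sum w_combination by (simp_all add: reindex u_def x_h)
  ultimately show thesis using that[of u x] by blast
qed

lemma zero_notin_convex_hull_minors2:
  fixes K :: "(real^'n^'m) set"
  assumes subspace: "subspace K" and dim: "dim K \<le> 3"
    and no_rank_1: "\<And>C. C \<in> K \<Longrightarrow> rank C \<noteq> 1"
  shows "0 \<notin> convex hull (minors2 ` (sphere 0 1 \<inter> K))"
proof
  assume "0 \<in> convex hull (minors2 ` (sphere 0 1 \<inter> K))"
  then obtain u :: "('m \<times> 'm \<times> 'n \<times> 'n) option \<Rightarrow> real" and x
    where u_nonneg: "\<And>i. 0 \<le> u i" and u_sum: "sum u UNIV = 1"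
      and x_in: "\<And>i. x i \<in> minors2 ` (sphere 0 1 \<inter> K)" and combination: "(\<Sum>i\<in>UNIV. u i *\<^sub>R x i) = 0"
    using convex_hull_caratheodory_indexed by blast
  have "\<exists>X. X \<in> sphere 0 1 \<inter> K \<and> x i = minors2 X" for i
    using x_in[of i] by blast
  then obtain X where X_in: "\<And>i. X i \<in> K" and unit: "\<And>i. norm (X i) = 1"
    and x_eq: "\<And>i. x i = minors2 (X i)"
    by (metis IntE mem_sphere_0)
  define Y where "Y i = sqrt (u i) *\<^sub>R X i" for i
  have "range Y \<subseteq> K"
    using X_in subspace by (auto simp: Y_def subspace_scale)
  then have span_Y: "span (range Y) \<subseteq> K" and dim_Y: "dim (range Y) \<le> 3"
    using span_minimal[OF _ subspace] dim_subset[of "range Y" K] dim by auto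
  have "(\<Sum>i\<in>UNIV. minors2 (Y i)) = 0"
    using combination u_nonneg by (simp add: Y_def minors2_scaleR x_eq)
  moreover obtain i\<^sub>0 where "u i\<^sub>0 \<noteq> 0"
    using u_sum by (metis sum.neutral zero_neq_one)
  then have "Y i\<^sub>0 \<noteq> 0"
    using unit[of i\<^sub>0] by (auto simp: Y_def)
  ultimately obtain C where "C \<in> span (range Y)" "rank C = 1"
    using ex_rank_1_if_sum_minors2_eq_0[OF dim_Y] by blast
  then show False using span_Y no_rank_1 by blast
qed

lemma ex_positive_definite_minors2:
  fixes K :: "(real^'n^'m) set"
  assumes subspace: "subspace K" and dim: "dim K \<le> 3"
    and no_rank_1: "\<And>C. C \<in> K \<Longrightarrow> rank C \<noteq> 1"
  obtains w where "\<And>X. X \<in> K \<Longrightarrow> X \<noteq> 0 \<Longrightarrow> w \<bullet> minors2 X > 0"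
proof -
  let ?C = "minors2 ` (sphere 0 1 \<inter> K)"
  have "compact (convex hull ?C)"
    by (intro compact_convex_hull compact_continuous_image continuous_on_minors2
        compact_sphere_Int_subspace subspace)
  then obtain w b where "0 < b" "\<And>z. z \<in> convex hull ?C \<Longrightarrow> w \<bullet> z > b"
    using separating_hyperplane_closed_0[of "convex hull ?C"] convex_convex_hull
      zero_notin_convex_hull_minors2[OF subspace dim no_rank_1] compact_imp_closed by metis
  then have pos: "w \<bullet> minors2 X > 0" if "X \<in> sphere 0 1 \<inter> K" for X
    using that hull_inc[of _ ?C] by (meson imageI less_trans)
  have "w \<bullet> minors2 X > 0" if "X \<in> K" "X \<noteq> 0" for X
    using pos[OF normalize_in_sphere_Int_subspace[OF subspace that]] that(2)
    by (simp add: minors2_scaleR zero_less_mult_iff zero_less_divide_iff)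
  then show thesis using that by blast
qed

section \<open>Minors and polyconvex measures\<close>

lemma det_k_Suc_0: "det_k (Suc 0) M = M 0 0"
proof -
  have "{p::nat \<Rightarrow> nat. p permutes {..<Suc 0}} = {id}"
    by (auto simp: lessThan_Suc)
  then show ?thesis by (simp add: det_k_def sign_id)
qed

lemma det_k_2: "det_k 2 M = M 0 0 * M 1 1 - M 0 1 * M 1 0"
proof -
  have "{..<2::nat} = {0, 1}" by auto
  then have "{p. p permutes {..<2::nat}} = {id, Transposition.transpose 0 1}"
    by (auto simp: permutes_doubleton_iff)
  moreover have "id \<noteq> Transposition.transpose (0::nat) 1"
    by (metis id_apply transpose_apply_first zero_neq_one)
  ultimately show ?thesis
    by (simp add: det_k_def sign_id sign_swap_id numeral_2_eq_2 lessThan_Suc mult.commute)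
qed

lemma sum_sign_permutations_eq_0:
  assumes "finite S" and "i \<in> S" "j \<in> S" "i \<noteq> j"
  shows "(\<Sum>p | p permutes S. sign p) = 0"
proof -
  let ?t = "Transposition.transpose i j"
  have "?t permutes S" using assms by (intro permutes_swap_id)
  then have "(\<Sum>p | p permutes S. sign p) = (\<Sum>p | p permutes S. sign (?t \<circ> p))"
    by (rule setum_permutations_compose_left)
  also have "\<dots> = (\<Sum>p | p permutes S. - sign p)"
    using permutes_imp_permutation[OF assms(1)] assms(4)
    by (intro sum.cong) (auto simp: sign_compose permutation_swap_id sign_swap_id)
  finally show ?thesis by (simp add: sum_negf)
qed

lemma det_k_product_eq_0:
  assumes "k \<ge> 2"
  shows "det_k k (\<lambda>i j. a i * b j) = 0"
proof -
  have "(\<Prod>i<k. a i * b (p i)) = (\<Prod>i<k. a i) * (\<Prod>i<k. b i)" if "p permutes {..<k}" for p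
    using prod.permute[OF that, of b] by (simp add: prod.distrib comp_def)
  then have "det_k k (\<lambda>i j. a i * b j) =
      of_int (\<Sum>p | p permutes {..<k}. sign p) * ((\<Prod>i<k. a i) * (\<Prod>i<k. b i))"
    unfolding det_k_def of_int_sum sum_distrib_right by (intro sum.cong) auto
  then show ?thesis
    using assms sum_sign_permutations_eq_0[of "{..<k}" 0 1] by simp
qed

lemma minors_scaleR_if_rank_1:
  fixes C :: "real^'n::{finite,linorder}^'m::{finite,linorder}"
  assumes "rank C = 1"
  shows "minors (t *\<^sub>R C) = t *\<^sub>R minors C"
proof -
  obtain a b where product: "\<And>i j. C $ i $ j = a i * b j"
    using assms unfolding rank_eq_1_iff by blast
  have "minor (t *\<^sub>R C) I J = t * minor C I J" if "card I \<ge> 1" for I J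
  proof (cases "card I = 1")
    case True
    then show ?thesis by (simp add: minor_def det_k_Suc_0)
  next
    case False
    with that have "card I \<ge> 2" by simp
    then have "minor (s *\<^sub>R C) I J = 0" for s
      using det_k_product_eq_0[of _ "\<lambda>i. s * a (sorted_list_of_set I ! i)"]
      by (simp add: minor_def product mult.assoc)
    from this[of t] this[of 1] show ?thesis by simp
  qed
  then show ?thesis by (simp add: minors_def vec_eq_iff)
qed

lemma continuous_on_minors: "continuous_on S minors"
proof -
  have "continuous_on S (\<lambda>X. minors X $ IJ)" for IJ
  proof (cases "card (fst IJ) = card (snd IJ) \<and> card (fst IJ) \<ge> 1")
    case True
    then have "(\<lambda>X. minors X $ IJ) = (\<lambda>X. minor X (fst IJ) (snd IJ))"
      by (simp add: minors_def)
    then show ?thesis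
      by (simp only: minor_def det_k_def) (intro continuous_intros)
  next
    case False
    then show ?thesis by (simp only: minors_def vec_lambda_beta if_False continuous_on_const)
  qed
  then show ?thesis using continuous_on_vec_lambda[of S "\<lambda>IJ X. minors X $ IJ"] by simp
qed

lemma minors_nth_doubletons:
  assumes "i < k" "j < l"
  shows "minors X $ ({i, k}, {j, l}) = minors2 X $ (i, k, j, l)"
proof -
  have "sorted_list_of_set {i, k} = [i, k]" "sorted_list_of_set {j, l} = [j, l]"
    using assms by (auto simp: sorted_list_of_set_insert_remove)
  moreover have "card {i, k} = 2" "card {j, l} = 2" using assms by auto
  ultimately show ?thesis by (simp add: minors_def minor_def det_k_2)
qed

lemma minors2_nth_eq_minors_nth:
  "\<exists>s IJ. \<forall>X :: real^'n::{finite,linorder}^'m::{finite,linorder}. minors2 X $ p = s * minors X $ IJ"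
proof -
  obtain i k j l where p_eq: "p = (i, k, j, l)" by (cases p)
  consider (degenerate) "i = k \<or> j = l" | (sorted) "i < k" "j < l" | (rows_swapped) "k < i" "j < l"
    | (columns_swapped) "i < k" "l < j" | (both_swapped) "k < i" "l < j"
    by (meson linorder_cases)
  then show ?thesis
  proof cases
    case degenerate
    then show ?thesis by (intro exI[of _ 0] exI) (auto simp: p_eq)
  next
    case sorted
    then show ?thesis
      by (intro exI[of _ 1] exI[of _ "({i, k}, {j, l})"]) (simp add: p_eq minors_nth_doubletons)
  next
    case rows_swapped
    then show ?thesis
      by (intro exI[of _ "-1"] exI[of _ "({k, i}, {j, l})"])
        (simp add: p_eq minors_nth_doubletons algebra_simps)
  next
    case columns_swapped
    then show ?thesis
      by (intro exI[of _ "-1"] exI[of _ "({i, k}, {l, j})"])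
        (simp add: p_eq minors_nth_doubletons algebra_simps)
  next
    case both_swapped
    then show ?thesis
      by (intro exI[of _ 1] exI[of _ "({k, i}, {l, j})"])
        (simp add: p_eq minors_nth_doubletons algebra_simps)
  qed
qed

lemma minors2_eq_linear_minors:
  obtains L where "linear L"
    and "\<And>X :: real^'n::{finite,linorder}^'m::{finite,linorder}. minors2 X = L (minors X)"
proof -
  obtain s IJ where nth_eq: "\<And>(X :: real^'n::{finite,linorder}^'m::{finite,linorder}) p.
      minors2 X $ p = s p * minors X $ IJ p"
    using minors2_nth_eq_minors_nth by metis
  show thesis
    by (rule that[of "\<lambda>z. \<chi> p. s p * z $ IJ p"])
      (auto intro!: linearI simp: vec_eq_iff nth_eq algebra_simps)
qed

definition minors2_polar :: "real^'n^'m \<Rightarrow> real^'n^'m \<Rightarrow> real^('m \<times> 'm \<times> 'n \<times> 'n)" where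
  "minors2_polar Z X = minors2 (X + Z) - minors2 X - minors2 Z"

lemma linear_minors2_polar: "linear (minors2_polar Z)"
  by (rule linearI) (auto simp: minors2_polar_def vec_eq_iff algebra_simps)

lemma minors2_polar_self: "minors2_polar Z Z = 2 *\<^sub>R minors2 Z"
  by (auto simp: minors2_polar_def vec_eq_iff algebra_simps)

lemma minors2_diff: "minors2 (X - Z) = minors2 X - minors2_polar Z X + minors2 Z"
  by (auto simp: minors2_polar_def vec_eq_iff algebra_simps)

lemma AE_in_Spt:
  fixes \<nu> :: "'a::{metric_space, second_countable_topology} measure"
  assumes "sets \<nu> = sets borel"
  shows "AE x in \<nu>. x \<in> Spt \<nu>"
proof -
  define F where "F = {ball x e | x e. emeasure \<nu> (ball x e) = 0}"
  have "open S" if "S \<in> F" for S using that by (auto simp: F_def)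
  then obtain F' where subset: "F' \<subseteq> F" and countable: "countable F'" and cover: "\<Union>F' = \<Union>F"
    using Lindelof by metis
  have "(\<Union>S\<in>F'. S) \<in> null_sets \<nu>"
    using subset countable assms by (intro null_sets_UN') (auto simp: null_sets_def F_def)
  moreover have "x \<in> \<Union>F" if "x \<notin> Spt \<nu>" for x
    using that centre_in_ball unfolding Spt_def F_def by blast
  then have "{x \<in> space \<nu>. x \<notin> Spt \<nu>} \<subseteq> (\<Union>S\<in>F'. S)"
    using cover by auto
  ultimately show ?thesis by (rule AE_I')
qed

lemma integral_in_subspace:
  fixes f :: "'a \<Rightarrow> 'b::euclidean_space"
  assumes integrable: "integrable M f" and subspace: "subspace S" and AE_in: "AE x in M. f x \<in> S"
  shows "integral\<^sup>L M f \<in> S"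
proof -
  have "z \<bullet> integral\<^sup>L M f = 0" if z_in: "z \<in> S\<^sup>\<bottom>" for z
  proof -
    have "z \<bullet> integral\<^sup>L M f = (\<integral>x. z \<bullet> f x \<partial>M)"
      using integrable by simp
    also have "\<dots> = 0"
      using AE_in by (intro integral_eq_zero_AE)
        (use z_in in \<open>auto simp: orthogonal_comp_def orthogonal_def inner_commute elim!: eventually_mono\<close>)
    finally show ?thesis .
  qed
  then have "integral\<^sup>L M f \<in> S\<^sup>\<bottom>\<^sup>\<bottom>"
    by (simp add: orthogonal_comp_def orthogonal_def)
  then show ?thesis by (simp add: orthogonal_comp_self subspace)
qed

abbreviation barycentre :: "'a::{banach, second_countable_topology} measure \<Rightarrow> 'a" where
  "barycentre \<nu> \<equiv> \<integral>x. x \<partial>\<nu>"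

lemma
  assumes "\<nu> \<in> Mpc K"
  shows Mpc_prob_space: "prob_space \<nu>"
    and Mpc_sets: "sets \<nu> = sets borel"
    and Mpc_AE_in: "AE X in \<nu>. X \<in> K"
    and Mpc_integrable_id: "integrable \<nu> (\<lambda>X. X)"
    and Mpc_integrable_minors: "integrable \<nu> minors"
    and Mpc_jensen: "polyconvex f \<Longrightarrow> integrable \<nu> f \<Longrightarrow> f (barycentre \<nu>) \<le> integral\<^sup>L \<nu> f"
  using assms AE_in_Spt[of \<nu>] by (auto simp: Mpc_def)

lemma polyconvex_inner_minors: "polyconvex (\<lambda>X. w \<bullet> minors X)"
  unfolding polyconvex_def
  by (intro exI[of _ "\<lambda>z. w \<bullet> z"]) (auto simp: convex_on_def inner_add_right)

lemma Mpc_integral_minors: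
  assumes "\<nu> \<in> Mpc K"
  shows "integral\<^sup>L \<nu> minors = minors (barycentre \<nu>)"
proof -
  note integrable = Mpc_integrable_minors[OF assms]
  have jensen: "w \<bullet> minors (barycentre \<nu>) \<le> w \<bullet> integral\<^sup>L \<nu> minors" for w
    using Mpc_jensen[OF assms polyconvex_inner_minors[of w]] integrable by simp
  have "w \<bullet> integral\<^sup>L \<nu> minors = w \<bullet> minors (barycentre \<nu>)" for w
    using jensen[of w] jensen[of "- w"] by simp
  then show ?thesis by (blast intro: vector_eq_ldot[THEN iffD1])
qed

lemma Mpc_integral_minors2_diff:
  fixes \<nu> :: "(real^'n::{finite,linorder}^'m::{finite,linorder}) measure"
  assumes polyconvex: "\<nu> \<in> Mpc K"
  shows "integrable \<nu> (\<lambda>X. minors2 (X - barycentre \<nu>))"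
    and "(\<integral>X. minors2 (X - barycentre \<nu>) \<partial>\<nu>) = 0"
proof -
  interpret prob_space \<nu> using Mpc_prob_space[OF polyconvex] .
  let ?Z = "barycentre \<nu>"
  obtain L where linear: "linear L"
    and minors2_eq: "\<And>X :: real^'n::{finite,linorder}^'m::{finite,linorder}. minors2 X = L (minors X)"
    using minors2_eq_linear_minors by blast
  have bounded_L: "bounded_linear L" and bounded_polar: "bounded_linear (minors2_polar ?Z)"
    using linear linear_minors2_polar by (simp_all add: linear_conv_bounded_linear)
  note integrable_id = Mpc_integrable_id[OF polyconvex]
    and integrable_minors = Mpc_integrable_minors[OF polyconvex]
  have integrable_minors2: "integrable \<nu> minors2"
    using integrable_bounded_linear[OF bounded_L integrable_minors] by (simp flip: minors2_eq)
  have integrable_polar: "integrable \<nu> (minors2_polar ?Z)"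
    by (rule integrable_bounded_linear[OF bounded_polar integrable_id])
  have "(\<integral>X. minors2 X \<partial>\<nu>) = minors2 ?Z"
    using integral_bounded_linear[OF bounded_L integrable_minors] Mpc_integral_minors[OF polyconvex]
    by (simp add: minors2_eq)
  moreover have "(\<integral>X. minors2_polar ?Z X \<partial>\<nu>) = 2 *\<^sub>R minors2 ?Z"
    using integral_bounded_linear[OF bounded_polar integrable_id] by (simp add: minors2_polar_self)
  ultimately show "(\<integral>X. minors2 (X - ?Z) \<partial>\<nu>) = 0"
    unfolding minors2_diff using integrable_minors2 integrable_polar
    by (simp add: prob_space scaleR_2)
  show "integrable \<nu> (\<lambda>X. minors2 (X - ?Z))"
    unfolding minors2_diff using integrable_minors2 integrable_polar by simp
qed

lemma Mpc_eq_return: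
  fixes K :: "(real^'n::{finite,linorder}^'m::{finite,linorder}) set"
  assumes subspace: "subspace K" and dim: "dim K \<le> 3"
    and no_rank_1: "\<And>C. C \<in> K \<Longrightarrow> rank C \<noteq> 1"
    and polyconvex: "\<nu> \<in> Mpc K"
  shows "\<nu> = return borel (barycentre \<nu>)"
proof -
  let ?Z = "barycentre \<nu>"
  interpret prob_space \<nu> using Mpc_prob_space[OF polyconvex] .
  obtain w where positive: "\<And>X. X \<in> K \<Longrightarrow> X \<noteq> 0 \<Longrightarrow> w \<bullet> minors2 X > 0"
    using ex_positive_definite_minors2[OF subspace dim no_rank_1] by metis
  define q where "q X = w \<bullet> minors2 (X - ?Z)" for X
  have integrable: "integrable \<nu> q" and integral: "integral\<^sup>L \<nu> q = 0"
    unfolding q_def using Mpc_integral_minors2_diff[OF polyconvex] by simp_all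
  have "?Z \<in> K"
    using integral_in_subspace[OF Mpc_integrable_id[OF polyconvex] subspace Mpc_AE_in[OF polyconvex]] .
  then have AE_K: "AE X in \<nu>. X - ?Z \<in> K"
    using Mpc_AE_in[OF polyconvex] by (auto elim!: eventually_mono intro: subspace_diff[OF subspace])
  have q_nonneg: "0 \<le> q X" and q_eq_0: "q X = 0 \<Longrightarrow> X = ?Z" if "X - ?Z \<in> K" for X
    using positive[OF that] by (cases "X = ?Z"; simp add: q_def)+
  have "AE X in \<nu>. 0 \<le> q X"
    using AE_K q_nonneg by (rule eventually_mono)
  then have "AE X in \<nu>. q X = 0"
    using integral_nonneg_eq_0_iff_AE[OF integrable] integral by blast
  with AE_K have "AE X in \<nu>. X = ?Z"
    by eventually_elim (rule q_eq_0)
  then have "\<nu> = return \<nu> ?Z"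
    by (rule AE_eq_constD)
  then show ?thesis
    using return_cong[OF Mpc_sets[OF polyconvex]] by metis
qed

section \<open>Finitely supported polyconvex measures\<close>

definition borel_measure_pmf :: "'a::topological_space pmf \<Rightarrow> 'a measure" where
  "borel_measure_pmf p = distr (measure_pmf p) borel (\<lambda>x. x)"

lemma measure_borel_measure_pmf_singleton:
  fixes p :: "'a::t1_space pmf"
  shows "measure (borel_measure_pmf p) {x} = pmf p x"
  by (simp add: borel_measure_pmf_def measure_distr measure_pmf_single)

lemma
  fixes f :: "'a::topological_space \<Rightarrow> 'b::{banach, second_countable_topology}"
  assumes "finite (set_pmf p)" and "f \<in> borel_measurable borel"
  shows integrable_borel_measure_pmf: "integrable (borel_measure_pmf p) f"
    and integral_borel_measure_pmf:
      "integral\<^sup>L (borel_measure_pmf p) f = (\<Sum>x\<in>set_pmf p. pmf p x *\<^sub>R f x)"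
  unfolding borel_measure_pmf_def using assms
  by (simp_all add: integrable_distr_eq integrable_measure_pmf_finite integral_distr
      integral_measure_pmf[of "set_pmf p"])

lemma Spt_borel_measure_pmf_subset:
  fixes p :: "'a::metric_space pmf"
  assumes "finite (set_pmf p)"
  shows "Spt (borel_measure_pmf p) \<subseteq> set_pmf p"
proof
  fix x assume in_Spt: "x \<in> Spt (borel_measure_pmf p)"
  show "x \<in> set_pmf p"
  proof (rule ccontr)
    assume "x \<notin> set_pmf p"
    moreover have "open (- set_pmf p)"
      using assms by (simp add: finite_imp_closed open_Compl)
    ultimately obtain e where e_pos: "e > 0" and ball: "ball x e \<subseteq> - set_pmf p"
      using open_contains_ball[of "- set_pmf p"] by auto
    have "emeasure (borel_measure_pmf p) (ball x e) = 0"
      using ball by (simp add: borel_measure_pmf_def emeasure_distr)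
        (subst measure_pmf.emeasure_eq_measure, auto simp: measure_pmf_zero_iff)
    with in_Spt e_pos show False by (simp add: Spt_def)
  qed
qed

lemma borel_measure_pmf_in_Mpc:
  fixes p :: "(real^'n::{finite,linorder}^'m::{finite,linorder}) pmf"
  assumes finite: "finite (set_pmf p)" and subset: "set_pmf p \<subseteq> K"
    and commute: "(\<Sum>X\<in>set_pmf p. pmf p X *\<^sub>R minors X) = minors (\<Sum>X\<in>set_pmf p. pmf p X *\<^sub>R X)"
  shows "borel_measure_pmf p \<in> Mpc K"
proof -
  let ?\<nu> = "borel_measure_pmf p"
  have "f (barycentre ?\<nu>) \<le> integral\<^sup>L ?\<nu> f"
    if polyconvex: "polyconvex f" and integrable: "integrable ?\<nu> f" for f
  proof -
    obtain g where convex: "convex_on UNIV g" and f_eq: "\<And>X. f X = g (minors X)"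
      using polyconvex by (auto simp: polyconvex_def)
    have measurable: "f \<in> borel_measurable borel"
      using borel_measurable_integrable[OF integrable] by (simp add: borel_measure_pmf_def)
    have "f (barycentre ?\<nu>) = g (\<Sum>X\<in>set_pmf p. pmf p X *\<^sub>R minors X)"
      by (simp add: integral_borel_measure_pmf finite f_eq commute)
    also have "\<dots> \<le> (\<Sum>X\<in>set_pmf p. pmf p X * g (minors X))"
      using finite convex
      by (intro convex_on_sum[where C = UNIV]) (auto simp: set_pmf_not_empty sum_pmf_eq_1)
    also have "\<dots> = integral\<^sup>L ?\<nu> f"
      using measurable by (simp add: integral_borel_measure_pmf finite f_eq)
    finally show ?thesis .
  qed
  moreover have "prob_space ?\<nu>"
    unfolding borel_measure_pmf_def by (intro measure_pmf.prob_space_distr) simp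
  moreover have "sets ?\<nu> = sets borel"
    by (simp add: borel_measure_pmf_def)
  ultimately show ?thesis
    unfolding Mpc_def using Spt_borel_measure_pmf_subset[OF finite] subset finite
    by (auto intro!: integrable_borel_measure_pmf borel_measurable_continuous_onI continuous_on_minors)
qed

lemma ex_Mpc_not_return:
  fixes K :: "(real^'n::{finite,linorder}^'m::{finite,linorder}) set"
  assumes subspace: "subspace K" and C_in: "C \<in> K" and rank: "rank C = 1"
  shows "\<exists>\<nu>\<in>Mpc K. \<forall>A. \<nu> \<noteq> return borel A"
proof -
  let ?p = "pmf_of_set {C, - C}"
  have "C \<noteq> 0" using rank by auto
  then have neq: "C \<noteq> - C"
    by (simp add: eq_neg_iff_add_eq_0 flip: scaleR_2)
  have pmf: "pmf ?p C = 1 / 2" "pmf ?p (- C) = 1 / 2"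
    using neq by simp_all
  have "minors (- C) = - minors C" "minors (0 *\<^sub>R C) = 0"
    using minors_scaleR_if_rank_1[OF rank, of "-1"] minors_scaleR_if_rank_1[OF rank, of 0] by simp_all
  then have "borel_measure_pmf ?p \<in> Mpc K"
    using neq C_in subspace_neg[OF subspace C_in]
    by (intro borel_measure_pmf_in_Mpc) (auto simp: pmf)
  moreover have "borel_measure_pmf ?p \<noteq> return borel A" for A
  proof
    assume "borel_measure_pmf ?p = return borel A"
    then have "pmf ?p C = indicator {C} A"
      using measure_borel_measure_pmf_singleton[of ?p C] by (simp add: measure_return)
    then show False by (cases "A = C") (simp_all add: pmf)
  qed
  ultimately show ?thesis by blast
qed

lemma subspace_rank1_connections_iff:
  assumes subspace: "subspace K"
  shows "rank1_connections K \<longleftrightarrow> (\<exists>C\<in>K. rank C = 1)"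
proof
  assume "rank1_connections K"
  then show "\<exists>C\<in>K. rank C = 1"
    using subspace_diff[OF subspace] unfolding rank1_connections_def by blast
next
  assume "\<exists>C\<in>K. rank C = 1"
  then obtain C where "C \<in> K" "rank C = 1" by blast
  moreover from this have "C \<noteq> 0" by auto
  ultimately show "rank1_connections K"
    unfolding rank1_connections_def
    by (intro bexI[of _ C] bexI[of _ 0]) (auto simp: subspace_0[OF subspace])
qed

theorem theorem2:
  fixes K :: "(real^'n::{finite,linorder}^'m::{finite,linorder}) set"
    and d :: nat
  assumes "d \<in> {1, 2, 3}"
    and "subspace K"
    and "dim K = d"
  shows "(\<forall>\<nu>\<in>Mpc K. \<exists>A. \<nu> = return borel A) \<longleftrightarrow> \<not> rank1_connections K"
proof
  assume "\<forall>\<nu>\<in>Mpc K. \<exists>A. \<nu> = return borel A"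
  then show "\<not> rank1_connections K"
    using ex_Mpc_not_return[OF assms(2)] subspace_rank1_connections_iff[OF assms(2)] by blast
next
  assume "\<not> rank1_connections K"
  then have "rank C \<noteq> 1" if "C \<in> K" for C
    using subspace_rank1_connections_iff[OF assms(2)] that by blast
  moreover have "dim K \<le> 3" using assms by auto
  ultimately show "\<forall>\<nu>\<in>Mpc K. \<exists>A. \<nu> = return borel A"
    using Mpc_eq_return[OF assms(2)] by blast
qed

end
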